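(* Let $X$ be a finite non-empty set and let $R$ be a monotone transit function on $X$. Then the following three conditions are equivalent: (w) for all $x,y,z\in X$: $z\in R(x,y)$ or $y\in R(x,z)$ or $x\in R(y,z)$; (w$_2$) for all $p,q,u,v,s,t\in X$: $R(p,q)\cap R(u,v)\cap R(s,t)\in\{R(p,q)\cap R(u,v),\ R(p,q)\cap R(s,t),\ R(u,v)\cap R(s,t)\}$; (w$_3$) for all $u,v,p,q,x,y,z\in X$: if $x\in R(u,v)\setminus R(p,q)$, $y\in R(u,v)\cap R(p,q)$ and $z\in R(p,q)\setminus R(u,v)$, then $y\in R(x,z)$.
   Context: A transit function on a finite non-empty set $X$ is a map $R:X\times X\to 2^X$ such that for all $u,v\in X$: $u\in R(u,v)$, $R(u,v)=R(v,u)$, and $R(u,u)=\{u\}$. $R$ is monotone if for all $u,v,p,q\in X$, $p,q\in R(u,v)$ implies $R(p,q)\subseteq R(u,v)$. *)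

theory Defs
  imports Main
begin

(* A map X \<times> X \<rightarrow> 2^X is represented by a curried function on the ambient type;
   its values are constrained only for arguments in X. *)
definition transit_function :: "'a set \<Rightarrow> ('a \<Rightarrow> 'a \<Rightarrow> 'a set) \<Rightarrow> bool" where
  "transit_function X R \<longleftrightarrow>
     (\<forall>u\<in>X. \<forall>v\<in>X. R u v \<subseteq> X) \<and>
     (\<forall>u\<in>X. \<forall>v\<in>X. u \<in> R u v) \<and>
     (\<forall>u\<in>X. \<forall>v\<in>X. R u v = R v u) \<and>
     (\<forall>u\<in>X. R u u = {u})"

definition monotone_transit :: "'a set \<Rightarrow> ('a \<Rightarrow> 'a \<Rightarrow> 'a set) \<Rightarrow> bool" where
  "monotone_transit X R \<longleftrightarrow>
     (\<forall>u\<in>X. \<forall>v\<in>X. \<forall>p\<in>X. \<forall>q\<in>X. p \<in> R u v \<and> q \<in> R u v \<longrightarrow> R p q \<subseteq> R u v)"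

definition axiom_w :: "'a set \<Rightarrow> ('a \<Rightarrow> 'a \<Rightarrow> 'a set) \<Rightarrow> bool" where
  "axiom_w X R \<longleftrightarrow>
     (\<forall>x\<in>X. \<forall>y\<in>X. \<forall>z\<in>X. z \<in> R x y \<or> y \<in> R x z \<or> x \<in> R y z)"

definition axiom_w2 :: "'a set \<Rightarrow> ('a \<Rightarrow> 'a \<Rightarrow> 'a set) \<Rightarrow> bool" where
  "axiom_w2 X R \<longleftrightarrow>
     (\<forall>p\<in>X. \<forall>q\<in>X. \<forall>u\<in>X. \<forall>v\<in>X. \<forall>s\<in>X. \<forall>t\<in>X.
        R p q \<inter> R u v \<inter> R s t \<in> {R p q \<inter> R u v, R p q \<inter> R s t, R u v \<inter> R s t})"

definition axiom_w3 :: "'a set \<Rightarrow> ('a \<Rightarrow> 'a \<Rightarrow> 'a set) \<Rightarrow> bool" where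
  "axiom_w3 X R \<longleftrightarrow>
     (\<forall>u\<in>X. \<forall>v\<in>X. \<forall>p\<in>X. \<forall>q\<in>X. \<forall>x\<in>X. \<forall>y\<in>X. \<forall>z\<in>X.
        x \<in> R u v - R p q \<and> y \<in> R u v \<inter> R p q \<and> z \<in> R p q - R u v \<longrightarrow> y \<in> R x z)"

end

theory Submission
  imports Defs
begin

text \<open>\<open>axiom_w\<close> is the hub: it is proved equivalent to each of the other two
  conditions. Monotonicity drives the implications out of it: a set \<open>R u v\<close> containing
  two points contains their whole transit set, so a point outside \<open>R u v\<close> is outside
  that transit set too, and this rules out alternatives of \<open>axiom_w\<close>. The implications
  back apply the other condition to transit sets spanned by \<open>x\<close>, \<open>y\<close>,
  \<open>z\<close> themselves.\<close>

lemma monotone_transitD: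
  assumes "transit_function X R" "monotone_transit X R"
    and "u \<in> X" "v \<in> X" "p \<in> R u v" "q \<in> R u v"
  shows "R p q \<subseteq> R u v"
proof -
  have "p \<in> X" "q \<in> X"
    using assms unfolding transit_function_def by blast+
  then show ?thesis
    using assms unfolding monotone_transit_def by blast
qed

lemma axiom_w_imp_axiom_w2:
  assumes "transit_function X R" "monotone_transit X R" "axiom_w X R"
  shows "axiom_w2 X R"
  unfolding axiom_w2_def
proof (intro ballI, rule ccontr)
  fix p q u v s t
  assume X: "p \<in> X" "q \<in> X" "u \<in> X" "v \<in> X" "s \<in> X" "t \<in> X"
    and *: "R p q \<inter> R u v \<inter> R s t \<notin> {R p q \<inter> R u v, R p q \<inter> R s t, R u v \<inter> R s t}"
  \<comment> \<open>As the triple intersection differs from each pairwise one, every two of the sets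
    share a point missing from the third. These points violate \<open>axiom_w\<close>.\<close>
  obtain x where x: "x \<in> R p q" "x \<in> R u v" "x \<notin> R s t" using * by blast
  obtain y where y: "y \<in> R p q" "y \<in> R s t" "y \<notin> R u v" using * by blast
  obtain z where z: "z \<in> R u v" "z \<in> R s t" "z \<notin> R p q" using * by blast
  have "R x y \<subseteq> R p q" "R x z \<subseteq> R u v" "R y z \<subseteq> R s t"
    using monotone_transitD[OF assms(1,2)] X x y z by blast+
  moreover have "x \<in> X" "y \<in> X" "z \<in> X"
    using assms(1) X x y z unfolding transit_function_def by blast+
  ultimately show False
    using assms(3) x y z unfolding axiom_w_def by blast
qed

text \<open>Any two of \<open>R x y\<close>, \<open>R x z\<close>, \<open>R y z\<close> share an
  endpoint. By \<open>axiom_w2\<close> some pairwise intersection lies in the third set, which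
  therefore contains that endpoint.\<close>

lemma axiom_w2_imp_axiom_w:
  assumes "transit_function X R" "axiom_w2 X R"
  shows "axiom_w X R"
  unfolding axiom_w_def
proof (intro ballI)
  fix x y z
  assume X: "x \<in> X" "y \<in> X" "z \<in> X"
  then have "R x y \<inter> R x z \<inter> R y z \<in> {R x y \<inter> R x z, R x y \<inter> R y z, R x z \<inter> R y z}"
    using assms(2) unfolding axiom_w2_def by blast
  moreover have "x \<in> R x y \<inter> R x z" "y \<in> R x y \<inter> R y z" "z \<in> R x z \<inter> R y z"
    using assms(1) X unfolding transit_function_def by blast+
  ultimately show "z \<in> R x y \<or> y \<in> R x z \<or> x \<in> R y z"
    by blast
qed

lemma axiom_w_imp_axiom_w3:
  assumes "transit_function X R" "monotone_transit X R" "axiom_w X R"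
  shows "axiom_w3 X R"
  unfolding axiom_w3_def
proof (intro ballI impI)
  fix u v p q x y z
  assume X: "u \<in> X" "v \<in> X" "p \<in> X" "q \<in> X" "x \<in> X" "y \<in> X" "z \<in> X"
    and *: "x \<in> R u v - R p q \<and> y \<in> R u v \<inter> R p q \<and> z \<in> R p q - R u v"
  \<comment> \<open>Hence \<open>z\<close> is not in \<open>R x y\<close> and \<open>x\<close> is
    not in \<open>R y z\<close>, leaving one alternative of \<open>axiom_w\<close>.\<close>
  have "R x y \<subseteq> R u v" "R y z \<subseteq> R p q"
    using monotone_transitD[OF assms(1,2)] X * by blast+
  then show "y \<in> R x z"
    using assms(3) X * unfolding axiom_w_def by blast
qed

lemma axiom_w3_imp_axiom_w:
  assumes "transit_function X R" "axiom_w3 X R"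
  shows "axiom_w X R"
  unfolding axiom_w_def
proof (intro ballI)
  fix x y z
  assume X: "x \<in> X" "y \<in> X" "z \<in> X"
  then have "x \<in> R x y" "y \<in> R x y" "x \<in> R x z" "z \<in> R x z"
    using assms(1) unfolding transit_function_def by blast+
  \<comment> \<open>The common endpoint \<open>x\<close> takes the middle role in
    \<open>axiom_w3\<close>; the premise holds exactly when the first two alternatives of
    \<open>axiom_w\<close> fail.\<close>
  moreover have "y \<in> R x y - R x z \<and> x \<in> R x y \<inter> R x z \<and> z \<in> R x z - R x y \<longrightarrow> x \<in> R y z"
    using assms(2) X unfolding axiom_w3_def by blast
  ultimately show "z \<in> R x y \<or> y \<in> R x z \<or> x \<in> R y z"
    by blast
qed

theorem theorem1:
  fixes X :: "'a set" and R :: "'a \<Rightarrow> 'a \<Rightarrow> 'a set"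
  assumes "finite X" and "X \<noteq> {}"
    and "transit_function X R"
    and "monotone_transit X R"
  shows "(axiom_w X R \<longleftrightarrow> axiom_w2 X R) \<and> (axiom_w2 X R \<longleftrightarrow> axiom_w3 X R)"
  using assms axiom_w_imp_axiom_w2 axiom_w2_imp_axiom_w axiom_w_imp_axiom_w3 axiom_w3_imp_axiom_w
  by metis

end
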